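(* Let $n\ge 1$ and let $\boldsymbol{p} > \boldsymbol{0}$ and $\boldsymbol{q} > \boldsymbol{0}$ be $n$-dimensional stochastic vectors. Then the matrix $\overline{V}$ corresponding to $(\boldsymbol{p},\boldsymbol{q})$ is an $M$-matrix.
   Context: Inequalities between vectors or matrices are entrywise; $\boldsymbol{1}$ is the all-ones vector, $\boldsymbol{0}$ the zero vector. A vector $\boldsymbol{a}\in\mathbb{R}^n$ is stochastic if $\boldsymbol{a}^\top\boldsymbol{1}=1$ and $\boldsymbol{a}\ge\boldsymbol{0}$. Write $[c]^+=\max\{c,0\}$ and $[c]^-=\min\{c,0\}$. The matrix $\overline{V}\in\mathbb{R}^{n\times n}$ corresponding to $(\boldsymbol{p},\boldsymbol{q})$ has entries $$\overline{v}_{ij}=\begin{cases}1-[1-q_i/p_i]^-, & i=j,\\ 0, & i\ne j \text{ and } \boldsymbol{p}=\boldsymbol{q},\\ \dfrac{[1-q_i/p_i]^-\,[p_j-q_j]^+}{\sum_{k=1}^n[p_k-q_k]^+}, & i\neq j\text{ and }\boldsymbol{p}\ne\boldsymbol{q}.\end{cases}$$ A $Z$-matrix is a real square matrix whose off-diagonal entries are all nonpositive. An $M$-matrix is (by the characterization used in the paper) a $Z$-matrix $A$ that is nonsingular with $A^{-1}\ge 0$ entrywise. *)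

theory Defs
  imports "HOL-Analysis.Analysis"
begin

(* In real ^ 'n ^ 'n the entry in row i and column j of A is A $ i $ j. *)

definition pos_part :: "real \<Rightarrow> real" where
  "pos_part c = max c 0"

(* The negative part is signed: it is min c 0, hence nonpositive. *)
definition neg_part :: "real \<Rightarrow> real" where
  "neg_part c = min c 0"

definition stochastic :: "real ^ 'n \<Rightarrow> bool" where
  "stochastic a \<longleftrightarrow> (\<Sum>i\<in>UNIV. a $ i) = 1 \<and> (\<forall>i. a $ i \<ge> 0)"

(* The library's strict order < on vectors is not the entrywise one: it only
   requires x \<le> y and x \<noteq> y. *)
definition positive_vec :: "real ^ 'n \<Rightarrow> bool" where
  "positive_vec a \<longleftrightarrow> (\<forall>i. a $ i > 0)"

definition V_bar :: "real ^ 'n \<Rightarrow> real ^ 'n \<Rightarrow> real ^ 'n ^ 'n" where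
  "V_bar p q = (\<chi> i j.
     if i = j then 1 - neg_part (1 - q $ i / p $ i)
     else if p = q then 0
     else neg_part (1 - q $ i / p $ i) * pos_part (p $ j - q $ j)
            / (\<Sum>k\<in>UNIV. pos_part (p $ k - q $ k)))"

definition Z_matrix :: "real ^ 'n ^ 'n \<Rightarrow> bool" where
  "Z_matrix A \<longleftrightarrow> (\<forall>i j. i \<noteq> j \<longrightarrow> A $ i $ j \<le> 0)"

definition M_matrix :: "real ^ 'n ^ 'n \<Rightarrow> bool" where
  "M_matrix A \<longleftrightarrow> Z_matrix A \<and> invertible A \<and> (\<forall>i j. matrix_inv A $ i $ j \<ge> 0)"

end

theory Submission
  imports Defs
begin

text \<open>
  Put \<open>a\<^sub>i = - neg_part (1 - q\<^sub>i / p\<^sub>i)\<close> and \<open>b\<^sub>j = pos_part (p\<^sub>j - q\<^sub>j) / S\<close>, where \<open>S\<close> is the sum of the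
  positive parts. Both vectors are nonnegative, and they have disjoint supports: \<open>a\<^sub>i \<noteq> 0\<close> forces
  \<open>q\<^sub>i > p\<^sub>i\<close>, while \<open>b\<^sub>i \<noteq> 0\<close> forces \<open>p\<^sub>i > q\<^sub>i\<close>. Hence the rank-one matrix \<open>a b\<^sup>T\<close> has zero diagonal and
  the matrix of the theorem is \<open>D - a b\<^sup>T\<close> with the diagonal matrix \<open>D = I + diag a\<close>.

  The Sherman--Morrison formula inverts such a rank-one update. Because of the disjoint supports,
  \<open>b\<^sup>T D\<^sup>-\<^sup>1 = b\<^sup>T\<close> and \<open>b\<^sup>T D\<^sup>-\<^sup>1 a = 0\<close>, so its denominator is 1 and the inverse is simply
  \<open>D\<^sup>-\<^sup>1 (I + a b\<^sup>T)\<close>, whose entries are visibly nonnegative.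
\<close>

lemma matrix_inv_unique:
  fixes A B :: "'a::semiring_1 ^ 'n ^ 'n"
  assumes AB: "A ** B = mat 1" and BA: "B ** A = mat 1"
  shows "matrix_inv A = B"
proof -
  have "A ** matrix_inv A = mat 1 \<and> matrix_inv A ** A = mat 1"
    unfolding matrix_inv_def using AB BA by (intro someI) auto
  then have "B ** (A ** matrix_inv A) = B"
    by simp
  then show ?thesis
    by (simp add: matrix_mul_assoc BA)
qed

text \<open>
  A one-sided inverse is enough, since the matrices are square. In the product, the \<open>k\<close>-th summand
  contains \<open>b\<^sub>k (\<delta>\<^sub>k\<^sub>j + a\<^sub>k b\<^sub>j) / (1 + a\<^sub>k)\<close>, which collapses to \<open>b\<^sub>k \<delta>\<^sub>k\<^sub>j\<close> whichever of \<open>a\<^sub>k\<close> and \<open>b\<^sub>k\<close>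
  vanishes.
\<close>

lemma M_matrix_diagonal_minus_rank_one:
  fixes a b :: "'n::finite \<Rightarrow> real"
  assumes a: "\<And>i. a i \<ge> 0" and b: "\<And>i. b i \<ge> 0" and ab: "\<And>i. a i * b i = 0"
  shows "M_matrix ((\<chi> i j. (if i = j then 1 + a i else 0) - a i * b j) :: real ^ 'n ^ 'n)"
    (is "M_matrix ?A")
proof -
  define W :: "real ^ 'n ^ 'n" where
    "W = (\<chi> i j. ((if i = j then 1 else 0) + a i * b j) / (1 + a i))"
  have pos: "1 + a i > 0" for i
    using a[of i] by linarith
  have collapse: "b k * W $ k $ j = (if k = j then b j else 0)" for k j
    using ab[of k] pos[of k] by (auto simp: W_def)
  have "(?A ** W) $ i $ j = mat 1 $ i $ j" for i j
  proof -
    have "(?A ** W) $ i $ j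
        = (\<Sum>k\<in>UNIV. (if i = k then (1 + a i) * W $ k $ j else 0) - a i * (b k * W $ k $ j))"
      by (auto simp: matrix_matrix_mult_def algebra_simps intro!: sum.cong)
    also have "\<dots> = (1 + a i) * W $ i $ j - a i * b j"
      by (simp add: sum_subtractf collapse flip: sum_distrib_left)
    also have "\<dots> = mat 1 $ i $ j"
      using pos[of i] by (simp add: W_def mat_def)
    finally show ?thesis .
  qed
  then have AW: "?A ** W = mat 1"
    by (simp add: vec_eq_iff)
  then have WA: "W ** ?A = mat 1"
    by (simp add: matrix_left_right_inverse)
  have inv: "invertible ?A"
    using AW WA by (auto simp: invertible_def)
  have "matrix_inv ?A = W"
    using AW WA by (rule matrix_inv_unique)
  moreover have "W $ i $ j \<ge> 0" for i j
    using a[of i] b[of j] by (simp add: W_def)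
  moreover note inv
  ultimately show ?thesis
    using a b by (simp add: M_matrix_def Z_matrix_def)
qed

theorem theorem11:
  fixes p q :: "real ^ 'n"
  assumes "positive_vec p" and "stochastic p"
    and "positive_vec q" and "stochastic q"
  shows "M_matrix (V_bar p q)"
proof -
  define a where "a i = - neg_part (1 - q $ i / p $ i)" for i
  define b where
    "b j = pos_part (p $ j - q $ j) / (\<Sum>k\<in>UNIV. pos_part (p $ k - q $ k))" for j
  have p: "p $ i > 0" for i
    using assms(1) by (simp add: positive_vec_def)
  have a: "a i \<ge> 0" for i
    by (simp add: a_def neg_part_def)
  have b: "b i \<ge> 0" for i
    by (simp add: b_def pos_part_def sum_nonneg)
  have ab: "a i * b i = 0" for i
    using p[of i] by (cases "p $ i \<le> q $ i") (auto simp: a_def b_def neg_part_def pos_part_def)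
  \<comment> \<open>For \<open>p = q\<close> the vector \<open>a\<close> vanishes, so the rank-one form also covers that case.\<close>
  have "a i = 0" if "p = q" for i
    using p[of i] that by (simp add: a_def neg_part_def)
  then have "V_bar p q = (\<chi> i j. (if i = j then 1 + a i else 0) - a i * b j)"
    using ab by (auto simp: V_bar_def vec_eq_iff a_def b_def)
  then show ?thesis
    using M_matrix_diagonal_minus_rank_one[OF a b ab] by simp
qed

end
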